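(* Let $A\in\mathbb{R}^{2\times 2}$ and $B\in\mathbb{R}^2$ be such that the linear system $\dot x=Ax+Bw$ is controllable, i.e. the $2\times2$ matrix $[B,\,AB]$ has full rank. Set $$m(A,B):=\min_{\lambda\in\mathbb{R}}\|AB-\lambda B\|=\left\|AB-\frac{\langle AB,B\rangle}{\|B\|^2}\,B\right\|>0 .$$ Let $f:\mathbb{R}^2\to\mathbb{R}^2$ be smooth with Jacobian $Df$ satisfying $$\|Df(x)\|<\frac{m(A,B)}{\|B\|}\qquad\text{for all }x\in\mathbb{R}^2 .$$ Then the planar control system $$\frac{dx(t)}{dt}=Ax(t)+Bw(t)+f(x(t))$$ is locally controllable (for every final time $T>0$ and every initial state $x_0\in\mathbb{R}^2$).
   Context: Here $\|\cdot\|$ on vectors is the Euclidean norm and on matrices is the induced operator norm; $\langle\cdot,\cdot\rangle$ is the Euclidean inner product. Controls $w$ are arbitrary smooth real-valued functions on $[0,T]$. The end-point map is $V_T[w,x_0]:=x(T)$, where $x$ solves the system with control $w$ and $x(0)=x_0$. The system is locally controllable (locally surjective) if for every control $w$ the derivative of the end-point map with respect to the control, $\delta w\mapsto dV_T|_w[\delta w]\in\mathbb{R}^2$ (with $\delta w$ ranging over smooth functions on $[0,T]$), is surjective onto $\mathbb{R}^2$. *)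

theory Defs
  imports "HOL-Analysis.Analysis"
begin

section \<open>Smoothness\<close>

text \<open>Derivatives at the end points of the interval are one-sided; the values of the function
  outside the interval are irrelevant.\<close>

definition smooth_on_interval :: "real \<Rightarrow> real \<Rightarrow> (real \<Rightarrow> real) \<Rightarrow> bool" where
  "smooth_on_interval a b w \<longleftrightarrow>
     (\<exists>d :: nat \<Rightarrow> real \<Rightarrow> real.
        (\<forall>t\<in>{a..b}. d 0 t = w t) \<and>
        (\<forall>n. \<forall>t\<in>{a..b}. (d n has_real_derivative d (Suc n) t) (at t within {a..b})))"

primrec Ck :: "nat \<Rightarrow> ('a::real_normed_vector \<Rightarrow> 'b::real_normed_vector) \<Rightarrow> bool" where
  "Ck 0 f \<longleftrightarrow> continuous_on UNIV f"
| "Ck (Suc k) f \<longleftrightarrow>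
     (\<forall>x. f differentiable (at x)) \<and> (\<forall>v. Ck k (\<lambda>x. frechet_derivative f (at x) v))"

definition smooth :: "('a::real_normed_vector \<Rightarrow> 'b::real_normed_vector) \<Rightarrow> bool" where
  "smooth f \<longleftrightarrow> (\<forall>k. Ck k f)"


section \<open>Control systems and the end-point map\<close>

text \<open>A control system with scalar control is given by its right-hand side \<open>g\<close>; it stands for
  the equation \<open>x'(t) = g (x(t)) (w(t))\<close>.\<close>

definition trajectory ::
  "('a::real_normed_vector \<Rightarrow> real \<Rightarrow> 'a) \<Rightarrow> real \<Rightarrow> (real \<Rightarrow> real) \<Rightarrow> 'a \<Rightarrow> (real \<Rightarrow> 'a) \<Rightarrow> bool" where
  "trajectory g T w x0 x \<longleftrightarrow>
     x 0 = x0 \<and>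
     (\<forall>t\<in>{0..T}. (x has_vector_derivative g (x t) (w t)) (at t within {0..T}))"

definition endpoint_map ::
  "('a::real_normed_vector \<Rightarrow> real \<Rightarrow> 'a) \<Rightarrow> real \<Rightarrow> (real \<Rightarrow> real) \<Rightarrow> 'a \<Rightarrow> 'a" where
  "endpoint_map g T w x0 = (THE y. \<exists>x. trajectory g T w x0 x \<and> x T = y)"

definition endpoint_map_defined ::
  "('a::real_normed_vector \<Rightarrow> real \<Rightarrow> 'a) \<Rightarrow> real \<Rightarrow> (real \<Rightarrow> real) \<Rightarrow> 'a \<Rightarrow> bool" where
  "endpoint_map_defined g T w x0 \<longleftrightarrow> (\<exists>!y. \<exists>x. trajectory g T w x0 x \<and> x T = y)"

text \<open>\<open>D\<close> is the derivative of the end-point map with respect to the control at \<open>w\<close>: a linear map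
  on the space of smooth functions on \<open>[0,T]\<close> whose value at \<open>\<delta>\<close> is the derivative of the
  end-point map in the direction \<open>\<delta>\<close>.  The values of \<open>D\<close> on other functions are irrelevant.\<close>

definition has_endpoint_derivative ::
  "('a::real_normed_vector \<Rightarrow> real \<Rightarrow> 'a) \<Rightarrow> real \<Rightarrow> (real \<Rightarrow> real) \<Rightarrow> 'a \<Rightarrow> ((real \<Rightarrow> real) \<Rightarrow> 'a) \<Rightarrow> bool"
  where
  "has_endpoint_derivative g T w x0 D \<longleftrightarrow>
     (\<forall>\<delta>. smooth_on_interval 0 T \<delta> \<longrightarrow>
        ((\<lambda>s. endpoint_map g T (\<lambda>t. w t + s * \<delta> t) x0) has_vector_derivative D \<delta>) (at 0)) \<and>
     (\<forall>\<delta> \<eta> a b. smooth_on_interval 0 T \<delta> \<longrightarrow> smooth_on_interval 0 T \<eta> \<longrightarrow>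
        D (\<lambda>t. a * \<delta> t + b * \<eta> t) = a *\<^sub>R D \<delta> + b *\<^sub>R D \<eta>)"

text \<open>The well-definedness of the end-point map is required for every control so that no
  statement about it can hold by virtue of the arbitrary value of \<open>THE\<close>.\<close>

definition locally_controllable ::
  "('a::real_normed_vector \<Rightarrow> real \<Rightarrow> 'a) \<Rightarrow> real \<Rightarrow> 'a \<Rightarrow> bool" where
  "locally_controllable g T x0 \<longleftrightarrow>
     (\<forall>w. smooth_on_interval 0 T w \<longrightarrow>
        endpoint_map_defined g T w x0 \<and>
        (\<exists>D. has_endpoint_derivative g T w x0 D \<and>
             D ` {\<delta>. smooth_on_interval 0 T \<delta>} = UNIV))"


section \<open>Planar linear systems\<close>

definition kalman_matrix :: "real^2^2 \<Rightarrow> real^2 \<Rightarrow> real^2^2" where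
  "kalman_matrix A B = transpose (vector [B, A *v B])"

definition linear_controllable :: "real^2^2 \<Rightarrow> real^2 \<Rightarrow> bool" where
  "linear_controllable A B \<longleftrightarrow> rank (kalman_matrix A B) = 2"

definition m_const :: "real^2^2 \<Rightarrow> real^2 \<Rightarrow> real" where
  "m_const A B = (INF l. norm (A *v B - l *\<^sub>R B))"

end

theory Submission
  imports Defs
begin

text \<open>
  Write \<open>F x = A *v x + f x\<close>. The bound on the Jacobian of \<open>f\<close> makes \<open>F\<close> globally Lipschitz, so every
  control has exactly one trajectory on \<open>[0,T]\<close> and the end-point map is well defined. Its derivative
  in the direction \<open>\<delta>\<close> is \<open>z T\<close>, where \<open>z\<close> solves the linearised equation \<open>z' = M t z + \<delta> t *\<^sub>R B\<close>,
  \<open>z 0 = 0\<close>, with \<open>M t\<close> the derivative of \<open>F\<close> at \<open>x t\<close>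
  (\<open>endpoint_map_has_vector_derivative\<close>); this follows from a growth estimate of Gronwall type
  (\<open>norm_growth_bound\<close>).

  Suppose the derivative is not onto. Then some \<open>p \<noteq> 0\<close> is orthogonal to its range. Let \<open>q\<close> solve the
  adjoint equation \<open>q' = - (M t)\<^sup>T q\<close> with \<open>q T = p\<close>. Since \<open>p \<bullet> z T\<close> is the integral of
  \<open>(q t \<bullet> B) * \<delta> t\<close>, the function \<open>q t \<bullet> B\<close> is orthogonal to all smooth functions, so it vanishes, and so
  does its derivative \<open>- q t \<bullet> M t B\<close>. At \<open>t = T\<close> the vector \<open>p\<close> is thus orthogonal to \<open>B\<close> and to
  \<open>M T B\<close> (\<open>endpoint_orthogonal_imp\<close>).

  In the plane this forces \<open>M T B = l *\<^sub>R B\<close> for some \<open>l\<close>. Hence \<open>A *v B - l *\<^sub>R B\<close> is minus the Jacobian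
  of \<open>f\<close> at \<open>x T\<close> applied to \<open>B\<close>. The norm of the former is at least \<open>m_const A B\<close>, that of the
  latter is less than \<open>m_const A B\<close>, a contradiction.
\<close>


section \<open>Initial value problems with Lipschitz right-hand side\<close>

definition ivp_solution ::
  "real \<Rightarrow> (real \<Rightarrow> 'a::real_normed_vector \<Rightarrow> 'a) \<Rightarrow> 'a \<Rightarrow> (real \<Rightarrow> 'a) \<Rightarrow> bool" where
  "ivp_solution T G x0 x \<longleftrightarrow>
     x 0 = x0 \<and> (\<forall>t\<in>{0..T}. (x has_vector_derivative G t (x t)) (at t within {0..T}))"

lemma ivp_solution_continuous:
  assumes "ivp_solution T G x0 x"
  shows "continuous_on {0..T} x"
  using assms unfolding ivp_solution_def
  by (intro continuous_on_vector_derivative[where f' = "\<lambda>t. G t (x t)"]) auto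

text \<open>A form of Gronwall's lemma that needs only an inner product: by
  \<open>2 * norm v * c \<le> (norm v)\<^sup>2 + c\<^sup>2\<close>, the function
  \<open>(norm (v t))\<^sup>2 * exp (- 2 * (L + 1) * t) - c\<^sup>2 * t\<close> is nonincreasing. The bound is linear in \<open>c\<close>;
  this turns a small defect in a differential equation into a proportionally small deviation of its
  solutions.\<close>

lemma norm_growth_bound:
  fixes v v' :: "real \<Rightarrow> 'a::real_inner"
  assumes v: "\<And>t. t \<in> {0..T} \<Longrightarrow> (v has_vector_derivative v' t) (at t within {0..T})"
    and bound: "\<And>t. t \<in> {0..T} \<Longrightarrow> norm (v' t) \<le> L * norm (v t) + c"
    and "v 0 = 0" "0 \<le> L" "0 \<le> c" and t: "t \<in> {0..T}"
  shows "norm (v t) \<le> c * (sqrt T * exp ((L + 1) * T))"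
proof -
  define \<phi> where "\<phi> = (\<lambda>t. (v t \<bullet> v t) * exp (- 2 * (L + 1) * t) - c\<^sup>2 * t)"
  have "\<phi> t \<le> \<phi> 0"
  proof (rule DERIV_nonpos_imp_decreasing_open[of 0 t \<phi>])
    show "0 \<le> t" using t by simp
    have "continuous_on {0..T} v"
      by (rule continuous_on_vector_derivative[OF v])
    then have "continuous_on {0..t} v"
      using t by (auto elim: continuous_on_subset)
    then show "continuous_on {0..t} \<phi>"
      unfolding \<phi>_def by (intro continuous_intros)
    fix s assume s: "0 < s" "s < t"
    then have "(v has_vector_derivative v' s) (at s)"
      using v[of s] t by (simp add: at_within_Icc_at)
    then have dv: "(v has_derivative (\<lambda>h. h *\<^sub>R v' s)) (at s)"
      by (simp add: has_vector_derivative_def)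
    define e where "e = exp (- 2 * (L + 1) * s)"
    have "((\<lambda>t. v t \<bullet> v t) has_real_derivative 2 * (v s \<bullet> v' s)) (at s)"
      unfolding has_field_derivative_def
      by (rule has_derivative_eq_rhs[OF has_derivative_inner[OF dv dv]])
        (auto simp: inner_commute)
    then have d: "(\<phi> has_real_derivative
        2 * (v s \<bullet> v' s) * e - 2 * (L + 1) * (v s \<bullet> v s) * e - c\<^sup>2) (at s)"
      unfolding \<phi>_def e_def
      by (auto intro!: derivative_eq_intros simp: algebra_simps)
    have "v s \<bullet> v' s \<le> norm (v s) * (L * norm (v s) + c)"
      using norm_cauchy_schwarz[of "v s" "v' s"] bound[of s] s t
      by (smt (verit, ccfv_SIG) atLeastAtMost_iff mult_left_mono norm_ge_zero)
    then have "2 * (v s \<bullet> v' s) - 2 * (L + 1) * (v s \<bullet> v s) \<le> 2 * norm (v s) * c - 2 * (norm (v s))\<^sup>2"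
      by (simp add: dot_square_norm algebra_simps power2_eq_square)
    also have "\<dots> \<le> c\<^sup>2"
      using sum_squares_bound[of "norm (v s)" c] zero_le_power2[of "norm (v s)"] by linarith
    finally have "(2 * (v s \<bullet> v' s) - 2 * (L + 1) * (v s \<bullet> v s)) * e \<le> c\<^sup>2 * e"
      by (intro mult_right_mono) (auto simp: e_def)
    also have "\<dots> \<le> c\<^sup>2"
      using s \<open>0 \<le> L\<close> by (intro mult_left_le) (auto simp: e_def mult_nonpos_nonneg)
    finally show "\<exists>y. DERIV \<phi> s :> y \<and> y \<le> 0"
      using d by (auto simp: algebra_simps)
  qed
  then have "(norm (v t))\<^sup>2 * exp (- (2 * (L + 1) * t)) \<le> c\<^sup>2 * t"
    by (simp add: \<phi>_def \<open>v 0 = 0\<close> dot_square_norm algebra_simps)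
  then have "(norm (v t))\<^sup>2 \<le> c\<^sup>2 * t * exp (2 * (L + 1) * t)"
    by (simp only: exp_minus divide_inverse[symmetric] pos_divide_le_eq exp_gt_zero)
  also have "\<dots> \<le> c\<^sup>2 * T * exp (2 * (L + 1) * T)"
    using t \<open>0 \<le> L\<close> by (intro mult_mono) auto
  also have "\<dots> = (c * (sqrt T * exp ((L + 1) * T)))\<^sup>2"
    using t by (simp add: power_mult_distrib mult_ac flip: exp_double)
  finally show ?thesis
    using t \<open>0 \<le> c\<close> by (simp add: power2_le_iff_abs_le abs_of_nonneg)
qed

lemma ivp_solution_unique:
  fixes G :: "real \<Rightarrow> 'a::real_inner \<Rightarrow> 'a"
  assumes lip: "\<And>t x y. t \<in> {0..T} \<Longrightarrow> norm (G t x - G t y) \<le> L * norm (x - y)"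
    and "0 \<le> L"
    and x: "ivp_solution T G x0 x" and y: "ivp_solution T G x0 y" and t: "t \<in> {0..T}"
  shows "x t = y t"
proof -
  have "norm (x t - y t) \<le> 0 * (sqrt T * exp ((L + 1) * T))"
  proof (rule norm_growth_bound[where v = "\<lambda>t. x t - y t" and v' = "\<lambda>t. G t (x t) - G t (y t)"])
    fix t assume "t \<in> {0..T}"
    then show "((\<lambda>t. x t - y t) has_vector_derivative G t (x t) - G t (y t)) (at t within {0..T})"
      using x y by (intro has_vector_derivative_diff) (auto simp: ivp_solution_def)
  qed (use assms in \<open>auto simp: ivp_solution_def\<close>)
  then show ?thesis by simp
qed

text \<open>Picard's operator is a contraction on the whole of \<open>[0,T]\<close>, without cutting the interval into
  short pieces, once distances are measured in the weighted norm
  \<open>sup norm (exp (- 2 * L * t) *\<^sub>R x t)\<close>. The substitution \<open>x t = exp (2 * L * t) *\<^sub>R u t\<close> turns this norm into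
  the plain supremum norm of \<open>u\<close>; the operator in terms of \<open>u\<close> is \<open>I\<close> below. Extension by constants
  outside \<open>[0,T]\<close> places it on the complete space of bounded continuous functions on the line.\<close>

lemma ivp_solution_exists:
  fixes G :: "real \<Rightarrow> 'a::banach \<Rightarrow> 'a"
  assumes cont: "continuous_on ({0..T} \<times> UNIV) (\<lambda>(t, x). G t x)"
    and lip: "\<And>t x y. t \<in> {0..T} \<Longrightarrow> norm (G t x - G t y) \<le> L * norm (x - y)"
    and "0 < L" "0 \<le> T"
  shows "\<exists>x. ivp_solution T G x0 x"
proof -
  define g where "g u s = G s (exp (2 * L * s) *\<^sub>R u s)" for u :: "real \<Rightarrow> 'a" and s
  define I where "I u t = exp (- 2 * L * t) *\<^sub>R (x0 + integral {0..t} (g u))"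
    for u :: "real \<Rightarrow> 'a" and t
  have cont_g: "continuous_on {0..T} (g u)" if "continuous_on {0..T} u" for u
    unfolding g_def
    by (rule continuous_on_compose2[OF cont, where f = "\<lambda>s. (s, exp (2 * L * s) *\<^sub>R u s)", simplified])
      (use that in \<open>auto intro!: continuous_intros\<close>)
  have cont_I: "continuous_on {0..T} (I u)" if "continuous_on {0..T} u" for u
    unfolding I_def
    by (intro continuous_intros indefinite_integral_continuous_1 integrable_continuous_real cont_g that)
  have ext: "ext_cont (I u) 0 T \<in> bcontfun" if "continuous_on {0..T} u" for u
  proof -
    have 1: "continuous_on UNIV (ext_cont (I u) 0 T)"
      using cont_I[OF that] by (intro continuous_on_ext_cont) auto
    have "bounded (I u ` {0..T})"
      using cont_I[OF that] by (intro compact_imp_bounded compact_continuous_image) auto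
    then have "bounded (range (ext_cont (I u) 0 T))"
      unfolding ext_cont_def
      by (intro clamp_bounded) auto
    with 1 show ?thesis by (simp add: bcontfun_def)
  qed
  define P where "P u = Bcontfun (ext_cont (I (apply_bcontfun u)) 0 T)" for u
  have P: "apply_bcontfun (P u) t = ext_cont (I (apply_bcontfun u)) 0 T t" for u t
    unfolding P_def by (subst Bcontfun_inverse[OF ext]) auto
  have contr: "dist (I u t) (I v t) \<le> 1/2 * d"
    if u: "continuous_on {0..T} u" and v: "continuous_on {0..T} v"
      and d: "\<And>s. norm (u s - v s) \<le> d" and t: "t \<in> {0..T}" for u v d t
  proof -
    have sub: "{0..t} \<subseteq> {0..T}" using t by auto
    have iu: "g u integrable_on {0..t}" and iv: "g v integrable_on {0..t}"
      using cont_g[OF u] cont_g[OF v] sub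
      by (auto intro!: integrable_continuous_real elim: continuous_on_subset)
    have hi: "((\<lambda>s. L * exp (2 * L * s) * d) has_integral
        (exp (2 * L * t) * d / 2 - exp (2 * L * 0) * d / 2)) {0..t}"
      using t \<open>0 < L\<close>
      by (intro fundamental_theorem_of_calculus)
        (auto intro!: derivative_eq_intros simp flip: has_real_derivative_iff_has_vector_derivative)
    have "norm (integral {0..t} (g u) - integral {0..t} (g v)) = norm (integral {0..t} (\<lambda>s. g u s - g v s))"
      by (simp add: integral_diff iu iv)
    also have "\<dots> \<le> integral {0..t} (\<lambda>s. L * exp (2 * L * s) * d)"
    proof (rule integral_norm_bound_integral)
      show "(\<lambda>s. g u s - g v s) integrable_on {0..t}" by (intro integrable_diff iu iv)
      show "(\<lambda>s. L * exp (2 * L * s) * d) integrable_on {0..t}" using hi by blast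
      fix s assume "s \<in> {0..t}"
      then have "norm (g u s - g v s) \<le> L * norm (exp (2 * L * s) *\<^sub>R (u s - v s))"
        unfolding g_def using lip[of s] sub by (auto simp: scaleR_diff_right)
      also have "\<dots> \<le> L * exp (2 * L * s) * d"
        using d[of s] \<open>0 < L\<close> by simp
      finally show "norm (g u s - g v s) \<le> L * exp (2 * L * s) * d" .
    qed
    also have "\<dots> = (exp (2 * L * t) - 1) * d / 2"
      using integral_unique[OF hi] by (simp add: algebra_simps)
    also have "\<dots> \<le> exp (2 * L * t) * d / 2"
      using order_trans[OF norm_ge_zero d] by (simp add: left_diff_distrib)
    finally have *: "norm (integral {0..t} (g u) - integral {0..t} (g v)) \<le> exp (2 * L * t) * d / 2" .
    have "dist (I u t) (I v t) = exp (- 2 * L * t) * norm (integral {0..t} (g u) - integral {0..t} (g v))"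
      by (simp add: I_def dist_norm flip: scaleR_diff_right)
    also have "\<dots> \<le> exp (- 2 * L * t) * (exp (2 * L * t) * d / 2)"
      using * by (intro mult_left_mono) auto
    also have "\<dots> = 1/2 * d"
      by (simp add: exp_minus field_simps)
    finally show ?thesis .
  qed
  have "\<exists>!u. P u = u"
  proof (rule banach_fix_type[where c = "1/2"])
    show "\<forall>u v. dist (P u) (P v) \<le> 1/2 * dist u v"
    proof (intro allI dist_bound)
      fix u v t
      show "dist (apply_bcontfun (P u) t) (apply_bcontfun (P v) t) \<le> 1/2 * dist u v"
        unfolding P ext_cont_def using \<open>0 \<le> T\<close>
        by (intro contr) (auto simp: dist_bounded clamp_in_interval[of 0 T, simplified] simp flip: dist_norm)
    qed
  qed auto
  then obtain u0 where "P u0 = u0" by blast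
  define u where "u = apply_bcontfun u0"
  define x where "x t = exp (2 * L * t) *\<^sub>R u t" for t
  have u: "u t = I u t" if "t \<in> {0..T}" for t
    using P[of u0 t] that unfolding \<open>P u0 = u0\<close> u_def by (simp add: ext_cont_def clamp_cancel_cbox[of t 0 T, simplified])
  have gu: "g u s = G s (x s)" for s
    by (simp add: g_def x_def)
  have x: "x t = x0 + integral {0..t} (g u)" if "t \<in> {0..T}" for t
    using u[OF that] by (simp add: x_def I_def flip: exp_add)
  have "(x has_vector_derivative G t (x t)) (at t within {0..T})" if t: "t \<in> {0..T}" for t
  proof (rule has_vector_derivative_transform[OF t])
    show "((\<lambda>t. x0 + integral {0..t} (g u)) has_vector_derivative G t (x t)) (at t within {0..T})"
      unfolding gu[symmetric]
      by (auto intro!: derivative_eq_intros integral_has_vector_derivative cont_g t simp: u_def)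
  qed (use x in auto)
  then show ?thesis
    using x[of 0] \<open>0 \<le> T\<close> unfolding ivp_solution_def by auto
qed


section \<open>Linear time-dependent systems and their adjoints\<close>

lemma linear_ivp_lipschitz:
  fixes M :: "real \<Rightarrow> 'a::euclidean_space \<Rightarrow>\<^sub>L 'a"
  assumes "continuous_on {0..T} M"
  obtains L where "0 < L"
    "\<And>t x y. t \<in> {0..T} \<Longrightarrow> norm ((M t x + b t) - (M t y + b t)) \<le> L * norm (x - y)"
proof -
  have "bounded (M ` {0..T})"
    using assms by (intro compact_imp_bounded compact_continuous_image) auto
  then obtain L where L: "0 < L" "\<And>t. t \<in> {0..T} \<Longrightarrow> norm (M t) \<le> L"
    unfolding bounded_pos by auto
  have "norm ((M t x + b t) - (M t y + b t)) \<le> L * norm (x - y)" if "t \<in> {0..T}" for t x y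
  proof -
    have "norm ((M t x + b t) - (M t y + b t)) = norm (M t (x - y))"
      by (simp add: blinfun.diff_right)
    also have "\<dots> \<le> norm (M t) * norm (x - y)" by (rule norm_blinfun)
    also have "\<dots> \<le> L * norm (x - y)" using L(2)[OF that] by (intro mult_right_mono) auto
    finally show ?thesis .
  qed
  with L(1) show ?thesis by (rule that)
qed

lemma linear_ivp_exists:
  fixes M :: "real \<Rightarrow> 'a::euclidean_space \<Rightarrow>\<^sub>L 'a"
  assumes M: "continuous_on {0..T} M" and b: "continuous_on {0..T} b" and "0 \<le> T"
  shows "\<exists>x. ivp_solution T (\<lambda>t x. M t x + b t) x0 x"
proof -
  obtain L where L: "0 < L"
    "\<And>t x y. t \<in> {0..T} \<Longrightarrow> norm ((M t x + b t) - (M t y + b t)) \<le> L * norm (x - y)"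
    by (rule linear_ivp_lipschitz[OF M, where b = b]) blast
  have "continuous_on ({0..T} \<times> UNIV) (\<lambda>p. M (fst p) (snd p) + b (fst p))"
    by (intro continuous_intros continuous_on_compose2[OF M] continuous_on_compose2[OF b]) auto
  then show ?thesis
    using ivp_solution_exists[OF _ L(2,1) \<open>0 \<le> T\<close>] by (simp add: split_beta)
qed

lemma linear_ivp_unique:
  fixes M :: "real \<Rightarrow> 'a::euclidean_space \<Rightarrow>\<^sub>L 'a"
  assumes "continuous_on {0..T} M"
    and "ivp_solution T (\<lambda>t x. M t x + b t) x0 x" "ivp_solution T (\<lambda>t x. M t x + b t) x0 y"
    and "t \<in> {0..T}"
  shows "x t = y t"
proof -
  obtain L where L: "0 < L"
    "\<And>t x y. t \<in> {0..T} \<Longrightarrow> norm ((M t x + b t) - (M t y + b t)) \<le> L * norm (x - y)"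
    by (rule linear_ivp_lipschitz[OF assms(1), where b = b]) blast
  then show ?thesis
    using ivp_solution_unique[OF L(2) _ assms(2-4)] by simp
qed

lemma linear_ivp_combination:
  fixes M :: "real \<Rightarrow> 'a::euclidean_space \<Rightarrow>\<^sub>L 'a"
  assumes "ivp_solution T (\<lambda>t x. M t x + b t) x0 x" "ivp_solution T (\<lambda>t x. M t x + c t) y0 y"
  shows "ivp_solution T (\<lambda>t x. M t x + (\<alpha> *\<^sub>R b t + \<beta> *\<^sub>R c t)) (\<alpha> *\<^sub>R x0 + \<beta> *\<^sub>R y0)
    (\<lambda>t. \<alpha> *\<^sub>R x t + \<beta> *\<^sub>R y t)"
  unfolding ivp_solution_def
proof (intro conjI ballI)
  fix t assume t: "t \<in> {0..T}"
  have "((\<lambda>t. \<alpha> *\<^sub>R x t + \<beta> *\<^sub>R y t) has_vector_derivative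
      \<alpha> *\<^sub>R (M t (x t) + b t) + \<beta> *\<^sub>R (M t (y t) + c t)) (at t within {0..T})"
    using assms t unfolding ivp_solution_def
    by (intro has_vector_derivative_add
        bounded_linear.has_vector_derivative[OF bounded_linear_scaleR_right]) auto
  then show "((\<lambda>t. \<alpha> *\<^sub>R x t + \<beta> *\<^sub>R y t) has_vector_derivative
      M t (\<alpha> *\<^sub>R x t + \<beta> *\<^sub>R y t) + (\<alpha> *\<^sub>R b t + \<beta> *\<^sub>R c t)) (at t within {0..T})"
    by (simp add: blinfun.add_right blinfun.scaleR_right algebra_simps)
qed (use assms in \<open>simp add: ivp_solution_def\<close>)

definition adjoint_blinfun :: "('a::euclidean_space \<Rightarrow>\<^sub>L 'a) \<Rightarrow> 'a \<Rightarrow>\<^sub>L 'a" where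
  "adjoint_blinfun M = Blinfun (adjoint (blinfun_apply M))"

lemma inner_adjoint_blinfun: "adjoint_blinfun M y \<bullet> x = y \<bullet> M x"
proof -
  have lin: "linear (blinfun_apply M)"
    by (simp add: blinfun.bounded_linear_right bounded_linear.linear)
  then have "bounded_linear (adjoint (blinfun_apply M))"
    using adjoint_linear linear_conv_bounded_linear by blast
  then have "adjoint_blinfun M y = adjoint (blinfun_apply M) y"
    by (simp add: adjoint_blinfun_def bounded_linear_Blinfun_apply)
  then show ?thesis
    using adjoint_works[OF lin, of x y] by (simp add: inner_commute)
qed

lemma continuous_on_adjoint_blinfun:
  fixes M :: "'t::t2_space \<Rightarrow> 'a::euclidean_space \<Rightarrow>\<^sub>L 'a"
  assumes "continuous_on S M"
  shows "continuous_on S (\<lambda>t. adjoint_blinfun (M t))"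
proof (rule continuous_on_blinfun_componentwise)
  fix i :: 'a assume "i \<in> Basis"
  have "adjoint_blinfun (M t) i = (\<Sum>j\<in>Basis. (i \<bullet> M t j) *\<^sub>R j)" for t
    using euclidean_representation[of "adjoint_blinfun (M t) i"]
    by (simp add: inner_adjoint_blinfun)
  then show "continuous_on S (\<lambda>t. adjoint_blinfun (M t) i)"
    using assms by (auto intro!: continuous_intros)
qed

text \<open>The adjoint equation has a terminal condition, so it is solved by reversing time.\<close>

lemma adjoint_ivp_exists:
  fixes M :: "real \<Rightarrow> 'a::euclidean_space \<Rightarrow>\<^sub>L 'a"
  assumes M: "continuous_on {0..T} M" and "0 \<le> T"
  obtains q where "q T = p"
    "\<And>t. t \<in> {0..T} \<Longrightarrow> (q has_vector_derivative - adjoint_blinfun (M t) (q t)) (at t within {0..T})"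
proof -
  have "continuous_on {0..T} (\<lambda>t. M (T - t))"
    by (intro continuous_on_compose2[OF M] continuous_intros) auto
  then have "continuous_on {0..T} (\<lambda>t. adjoint_blinfun (M (T - t)))"
    by (rule continuous_on_adjoint_blinfun)
  from linear_ivp_exists[OF this _ \<open>0 \<le> T\<close>, of "\<lambda>_. 0" p]
  obtain r where r: "ivp_solution T (\<lambda>t x. adjoint_blinfun (M (T - t)) x + 0) p r"
    by auto
  show thesis
  proof (rule that[of "r \<circ> (\<lambda>t. T - t)"])
    show "(r \<circ> (\<lambda>t. T - t)) T = p"
      using r by (simp add: ivp_solution_def)
    fix t assume t: "t \<in> {0..T}"
    have "((r \<circ> (\<lambda>t. T - t)) has_vector_derivative (-1) *\<^sub>R adjoint_blinfun (M t) (r (T - t))) (at t within {0..T})"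
    proof (rule vector_diff_chain_within)
      show "((\<lambda>t. T - t) has_vector_derivative - 1) (at t within {0..T})"
        by (auto intro!: derivative_eq_intros)
      have "T - t \<in> {0..T}" using t by auto
      then show "(r has_vector_derivative adjoint_blinfun (M t) (r (T - t)))
          (at (T - t) within (\<lambda>t. T - t) ` {0..T})"
        using r unfolding ivp_solution_def by (fastforce simp: image_diff_atLeastAtMost)
    qed
    then show "((r \<circ> (\<lambda>t. T - t)) has_vector_derivative
        - adjoint_blinfun (M t) ((r \<circ> (\<lambda>t. T - t)) t)) (at t within {0..T})"
      by simp
  qed
qed

text \<open>The adjoint equation is chosen so that \<open>M\<close> cancels in the derivative of \<open>q t \<bullet> z t\<close>. The
  component of the end point in the direction \<open>q T\<close> thereby becomes an explicit linear functional
  of the control variation.\<close>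

lemma adjoint_pairing_has_integral:
  fixes M :: "real \<Rightarrow> 'a::euclidean_space \<Rightarrow>\<^sub>L 'a"
  assumes q: "\<And>t. t \<in> {0..T} \<Longrightarrow>
      (q has_vector_derivative - adjoint_blinfun (M t) (q t)) (at t within {0..T})"
    and z: "ivp_solution T (\<lambda>t z. M t z + \<delta> t *\<^sub>R B) 0 z" and "0 \<le> T"
  shows "((\<lambda>t. (q t \<bullet> B) * \<delta> t) has_integral q T \<bullet> z T) {0..T}"
proof -
  have "((\<lambda>t. (q t \<bullet> B) * \<delta> t) has_integral q T \<bullet> z T - q 0 \<bullet> z 0) {0..T}"
  proof (rule fundamental_theorem_of_calculus)
    fix t assume t: "t \<in> {0..T}"
    have "((\<lambda>t. q t \<bullet> z t) has_vector_derivative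
        q t \<bullet> (M t (z t) + \<delta> t *\<^sub>R B) + (- adjoint_blinfun (M t) (q t)) \<bullet> z t) (at t within {0..T})"
      using q[OF t] z t unfolding ivp_solution_def
      by (intro bounded_bilinear.has_vector_derivative[OF bounded_bilinear_inner]) auto
    then show "((\<lambda>t. q t \<bullet> z t) has_vector_derivative (q t \<bullet> B) * \<delta> t) (at t within {0..T})"
      by (simp add: inner_adjoint_blinfun inner_add_right mult.commute)
  qed fact
  then show ?thesis using z by (simp add: ivp_solution_def)
qed


section \<open>Testing against smooth functions\<close>

lemma smooth_on_interval_continuous:
  assumes "smooth_on_interval a b w"
  shows "continuous_on {a..b} w"
proof -
  obtain d :: "nat \<Rightarrow> real \<Rightarrow> real" where d: "\<And>t. t \<in> {a..b} \<Longrightarrow> d 0 t = w t"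
    "\<And>t. t \<in> {a..b} \<Longrightarrow> (d 0 has_real_derivative d (Suc 0) t) (at t within {a..b})"
    using assms unfolding smooth_on_interval_def by metis
  then have "continuous_on {a..b} (d 0)"
    by (intro DERIV_continuous_on)
  then show ?thesis using d(1) by (simp cong: continuous_on_cong_simp)
qed

lemma smooth_on_interval_combination:
  assumes "smooth_on_interval a b \<delta>" "smooth_on_interval a b \<eta>"
  shows "smooth_on_interval a b (\<lambda>t. \<alpha> * \<delta> t + \<beta> * \<eta> t)"
proof -
  obtain d e where
    "\<And>t. t \<in> {a..b} \<Longrightarrow> d 0 t = \<delta> t" "\<And>t. t \<in> {a..b} \<Longrightarrow> e 0 t = \<eta> t"
    "\<And>n t. t \<in> {a..b} \<Longrightarrow> (d n has_real_derivative d (Suc n) t) (at t within {a..b})"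
    "\<And>n t. t \<in> {a..b} \<Longrightarrow> (e n has_real_derivative e (Suc n) t) (at t within {a..b})"
    using assms unfolding smooth_on_interval_def by metis
  then show ?thesis
    unfolding smooth_on_interval_def
    by (intro exI[of _ "\<lambda>n t. \<alpha> * d n t + \<beta> * e n t"])
      (auto intro!: DERIV_add DERIV_cmult)
qed

lemma smooth_on_interval_polynomial:
  assumes "real_polynomial_function p"
  shows "smooth_on_interval a b p"
proof -
  obtain D where D: "\<And>p. real_polynomial_function p \<Longrightarrow> real_polynomial_function (D p)"
    "\<And>p x. real_polynomial_function p \<Longrightarrow> (p has_real_derivative D p x) (at x)"
    using has_real_derivative_polynomial_function by metis
  have "real_polynomial_function ((D ^^ n) p)" for n
    by (induction n) (use assms D in auto)
  then show ?thesis
    unfolding smooth_on_interval_def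
    by (intro exI[of _ "\<lambda>n. (D ^^ n) p"]) (auto intro: has_field_derivative_at_within D(2))
qed

text \<open>Polynomials already suffice as test functions: approximating \<open>\<psi>\<close> uniformly by one of them makes
  the integral of \<open>\<psi>\<^sup>2\<close> arbitrarily small.\<close>

lemma zero_if_orthogonal_to_smooth:
  assumes "a < b" and \<psi>: "continuous_on {a..b} \<psi>"
    and orth: "\<And>\<delta>. smooth_on_interval a b \<delta> \<Longrightarrow> integral {a..b} (\<lambda>t. \<psi> t * \<delta> t) = 0"
    and t: "t \<in> {a..b}"
  shows "\<psi> t = 0"
proof -
  have int: "(\<lambda>t. \<psi> t * h t) integrable_on {a..b}" if "continuous_on {a..b} h" for h
    using \<psi> that by (intro integrable_continuous_real continuous_intros)
  have iabs: "(\<lambda>t. \<bar>\<psi> t\<bar>) integrable_on {a..b}"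
    using \<psi> by (intro integrable_continuous_real continuous_intros)
  define K where "K = integral {a..b} (\<lambda>t. \<bar>\<psi> t\<bar>)"
  have "integral {a..b} (\<lambda>t. \<psi> t * \<psi> t) \<le> 0 + e" if "0 < e" for e
  proof -
    have "0 \<le> K" unfolding K_def by (rule integral_nonneg) (auto simp: iabs)
    define e' where "e' = e / (K + 1)"
    have "0 < e'" using that \<open>0 \<le> K\<close> by (simp add: e'_def)
    then obtain p where p: "real_polynomial_function p" "\<And>t. t \<in> {a..b} \<Longrightarrow> \<bar>\<psi> t - p t\<bar> < e'"
      using Stone_Weierstrass_real_polynomial_function[OF _ \<psi>] by auto
    have sp: "smooth_on_interval a b p" by (rule smooth_on_interval_polynomial) fact
    have cp: "continuous_on {a..b} p" by (rule smooth_on_interval_continuous) fact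
    have "integral {a..b} (\<lambda>t. \<psi> t * \<psi> t) = integral {a..b} (\<lambda>t. \<psi> t * \<psi> t - \<psi> t * p t)"
      by (simp add: integral_diff int \<psi> cp orth[OF sp])
    also have "\<dots> \<le> integral {a..b} (\<lambda>t. e' * \<bar>\<psi> t\<bar>)"
    proof (rule integral_le)
      fix t assume "t \<in> {a..b}"
      have "\<psi> t * \<psi> t - \<psi> t * p t \<le> \<bar>\<psi> t\<bar> * \<bar>\<psi> t - p t\<bar>"
        by (simp add: abs_ge_self right_diff_distrib flip: abs_mult)
      also have "\<dots> \<le> \<bar>\<psi> t\<bar> * e'"
        using p(2)[OF \<open>t \<in> {a..b}\<close>] by (intro mult_left_mono) auto
      finally show "\<psi> t * \<psi> t - \<psi> t * p t \<le> e' * \<bar>\<psi> t\<bar>" by (simp add: mult.commute)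
    qed (use \<psi> cp in \<open>auto intro!: integrable_continuous_real continuous_intros\<close>)
    also have "\<dots> = e * (K / (K + 1))" by (simp add: K_def e'_def)
    also have "\<dots> \<le> e" using that \<open>0 \<le> K\<close> by (intro mult_left_le) auto
    finally show ?thesis by simp
  qed
  then have "integral {a..b} (\<lambda>t. \<psi> t * \<psi> t) \<le> 0" by (rule field_le_epsilon)
  moreover have "0 \<le> integral {a..b} (\<lambda>t. \<psi> t * \<psi> t)" by (rule integral_nonneg) (auto simp: int \<psi>)
  ultimately have "integral {a..b} (\<lambda>t. \<psi> t * \<psi> t) = 0" by simp
  then have "\<forall>t\<in>{a..b}. \<psi> t * \<psi> t = 0"
    using \<open>a < b\<close> \<psi> by (subst (asm) integral_eq_0_iff) (auto intro!: continuous_intros)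
  then show ?thesis using t by simp
qed

text \<open>If \<open>p\<close> is orthogonal to every end point, the adjoint solution \<open>q\<close> through \<open>q T = p\<close> satisfies
  \<open>q t \<bullet> B = 0\<close> on all of \<open>[0,T]\<close>, since this function is orthogonal to all smooth functions. The value and the
  one-sided derivative of \<open>q t \<bullet> B\<close> at \<open>T\<close> give the two conclusions.\<close>

lemma endpoint_orthogonal_imp:
  fixes M :: "real \<Rightarrow> 'a::euclidean_space \<Rightarrow>\<^sub>L 'a"
  assumes "0 < T" and M: "continuous_on {0..T} M"
    and orth: "\<And>\<delta> z. smooth_on_interval 0 T \<delta> \<Longrightarrow>
      ivp_solution T (\<lambda>t z. M t z + \<delta> t *\<^sub>R B) 0 z \<Longrightarrow> p \<bullet> z T = 0"
  shows "p \<bullet> B = 0" and "p \<bullet> M T B = 0"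
proof -
  obtain q where q: "q T = p"
    "\<And>t. t \<in> {0..T} \<Longrightarrow> (q has_vector_derivative - adjoint_blinfun (M t) (q t)) (at t within {0..T})"
    using adjoint_ivp_exists[OF M, of p] \<open>0 < T\<close> by auto
  have cq: "continuous_on {0..T} q"
    by (rule continuous_on_vector_derivative[OF q(2)])
  have zero: "q t \<bullet> B = 0" if "t \<in> {0..T}" for t
  proof (rule zero_if_orthogonal_to_smooth[OF \<open>0 < T\<close> _ _ that])
    show "continuous_on {0..T} (\<lambda>t. q t \<bullet> B)" using cq by (intro continuous_intros)
    fix \<delta> assume \<delta>: "smooth_on_interval 0 T \<delta>"
    have "continuous_on {0..T} (\<lambda>t. \<delta> t *\<^sub>R B)"
      by (intro continuous_intros smooth_on_interval_continuous \<delta>)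
    from linear_ivp_exists[OF M this, of 0] \<open>0 < T\<close>
    obtain z where z: "ivp_solution T (\<lambda>t z. M t z + \<delta> t *\<^sub>R B) 0 z" by auto
    have "((\<lambda>t. (q t \<bullet> B) * \<delta> t) has_integral q T \<bullet> z T) {0..T}"
      using adjoint_pairing_has_integral[OF q(2) z] \<open>0 < T\<close> by simp
    then show "integral {0..T} (\<lambda>t. (q t \<bullet> B) * \<delta> t) = 0"
      using orth[OF \<delta> z] q(1) by (simp add: integral_unique)
  qed
  have T: "T \<in> {0..T}" using \<open>0 < T\<close> by simp
  show "p \<bullet> B = 0" using zero[OF T] q(1) by simp
  have "((\<lambda>t. q t \<bullet> B) has_vector_derivative (- adjoint_blinfun (M T) (q T)) \<bullet> B) (at T within {0..T})"
    by (rule bounded_linear.has_vector_derivative[OF bounded_linear_inner_left q(2)[OF T]])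
  moreover have "((\<lambda>t. q t \<bullet> B) has_vector_derivative 0) (at T within {0..T})"
    by (rule has_vector_derivative_transform[OF T _ has_vector_derivative_const]) (use zero in auto)
  ultimately have "(- adjoint_blinfun (M T) (q T)) \<bullet> B = 0"
    using \<open>0 < T\<close>
    by (intro vector_derivative_unique_within_closed_interval[of 0 T T]) simp_all
  then show "p \<bullet> M T B = 0" using q(1) by (simp add: inner_adjoint_blinfun)
qed


section \<open>The end-point map of a globally Lipschitz control-affine system\<close>

locale control_affine =
  fixes F :: "'a::euclidean_space \<Rightarrow> 'a" and F' :: "'a \<Rightarrow> 'a \<Rightarrow>\<^sub>L 'a" and L :: real and B :: 'a
  assumes has_derivative_F: "\<And>x. (F has_derivative blinfun_apply (F' x)) (at x)"
    and continuous_F': "continuous_on UNIV F'"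
    and norm_F'_le: "\<And>x. norm (F' x) \<le> L"
    and L_pos: "0 < L"
begin

abbreviation rhs :: "'a \<Rightarrow> real \<Rightarrow> 'a" where
  "rhs \<equiv> \<lambda>x u. F x + u *\<^sub>R B"

lemma lipschitz_F: "norm (F x - F y) \<le> L * norm (x - y)"
  using differentiable_bound[of UNIV F "\<lambda>x. blinfun_apply (F' x)" L x y] has_derivative_F norm_F'_le
  by (simp add: norm_blinfun.rep_eq)

lemma continuous_F: "continuous_on S F"
  by (meson continuous_at_imp_continuous_on has_derivative_continuous has_derivative_F)

lemma trajectory_iff_ivp: "trajectory rhs T w x0 x \<longleftrightarrow> ivp_solution T (\<lambda>t x. F x + w t *\<^sub>R B) x0 x"
  by (simp add: trajectory_def ivp_solution_def)

lemma trajectory_exists: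
  assumes w: "continuous_on {0..T} w" and "0 \<le> T"
  shows "\<exists>x. trajectory rhs T w x0 x"
  unfolding trajectory_iff_ivp
proof (rule ivp_solution_exists[OF _ _ L_pos \<open>0 \<le> T\<close>])
  show "continuous_on ({0..T} \<times> UNIV) (\<lambda>(t, x). F x + w t *\<^sub>R B)"
    unfolding split_beta
    by (intro continuous_intros continuous_on_compose2[OF w] continuous_on_compose2[OF continuous_F[of UNIV]]) auto
qed (use lipschitz_F in simp)

lemma trajectory_unique:
  assumes "trajectory rhs T w x0 x" "trajectory rhs T w x0 y" "t \<in> {0..T}"
  shows "x t = y t"
  using ivp_solution_unique[of T "\<lambda>t x. F x + w t *\<^sub>R B" L] lipschitz_F L_pos assms
  by (simp add: trajectory_iff_ivp)

lemma endpoint_map_eq: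
  assumes "trajectory rhs T w x0 x" "0 \<le> T"
  shows "endpoint_map rhs T w x0 = x T"
  unfolding endpoint_map_def
proof (rule the_equality)
  fix y assume "\<exists>x'. trajectory rhs T w x0 x' \<and> x' T = y"
  then obtain x' where "trajectory rhs T w x0 x'" "x' T = y" by blast
  then show "y = x T"
    using trajectory_unique[OF _ assms(1), of x' T] assms(2) by simp
qed (use assms in blast)

lemma endpoint_map_defined:
  assumes "continuous_on {0..T} w" "0 \<le> T"
  shows "endpoint_map_defined rhs T w x0"
proof -
  obtain x where "trajectory rhs T w x0 x" using trajectory_exists[OF assms] by blast
  then show ?thesis
    unfolding endpoint_map_defined_def
    using trajectory_unique assms(2) by (metis atLeastAtMost_iff order_refl)
qed

text \<open>The modulus of differentiability is uniform on a compact set because \<open>F'\<close> is uniformly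
  continuous on a bounded neighbourhood of it. This is what controls the remainder along a whole
  trajectory at once.\<close>

lemma linearisation_error:
  assumes "compact K" "0 < e"
  obtains d where "0 < d"
    "\<And>x y. x \<in> K \<Longrightarrow> norm (y - x) < d \<Longrightarrow> norm (F y - F x - F' x (y - x)) \<le> e * norm (y - x)"
proof -
  obtain R where R: "\<And>x. x \<in> K \<Longrightarrow> norm x \<le> R"
    using \<open>compact K\<close> by (meson bounded_iff compact_imp_bounded)
  have "uniformly_continuous_on (cball 0 (R + 1)) F'"
    by (intro compact_uniformly_continuous continuous_on_subset[OF continuous_F']) auto
  then obtain d where d: "0 < d"
    "\<And>x y. x \<in> cball 0 (R + 1) \<Longrightarrow> y \<in> cball 0 (R + 1) \<Longrightarrow> dist y x < d \<Longrightarrow> dist (F' y) (F' x) < e"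
    using \<open>0 < e\<close> unfolding uniformly_continuous_on_def by metis
  show thesis
  proof (rule that[of "min d 1"])
    fix x y assume x: "x \<in> K" and y: "norm (y - x) < min d 1"
    let ?S = "ball x (min d 1)"
    have "norm (F y - F x - F' x (y - x)) \<le> norm (y - x) * e"
    proof (rule differentiable_bound_linearization[where S = ?S and f' = "\<lambda>x. blinfun_apply (F' x)"])
      fix t :: real assume t: "t \<in> {0..1}"
      have "norm (t *\<^sub>R (y - x)) \<le> norm (y - x)"
        using t by (simp add: mult_left_le_one_le)
      then show "x + t *\<^sub>R (y - x) \<in> ?S"
        using y by (simp add: dist_norm)
    next
      fix u assume u: "u \<in> ?S"
      show "(F has_derivative blinfun_apply (F' u)) (at u within ?S)"
        by (rule has_derivative_at_withinI[OF has_derivative_F])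
      have "norm u \<le> norm x + norm (u - x)"
        using norm_triangle_ineq[of x "u - x"] by simp
      then have "norm (F' u - F' x) < e"
        using u R[OF x] d(2)[of x u] by (simp add: dist_norm norm_minus_commute)
      then show "onorm (blinfun_apply (F' u) - blinfun_apply (F' x)) \<le> e"
        by (simp add: norm_blinfun.rep_eq minus_blinfun.rep_eq fun_diff_def)
    qed (use d(1) in simp)
    then show "norm (F y - F x - F' x (y - x)) \<le> e * norm (y - x)"
      by (simp add: mult.commute)
  qed (use d(1) in simp)
qed

lemma trajectory_continuous: "trajectory rhs T w x0 x \<Longrightarrow> continuous_on {0..T} x"
  unfolding trajectory_iff_ivp by (rule ivp_solution_continuous)

lemma continuous_linearisation:
  "trajectory rhs T w x0 x \<Longrightarrow> continuous_on {0..T} (\<lambda>t. F' (x t))"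
  by (rule continuous_on_compose2[OF continuous_F' trajectory_continuous]) auto

text \<open>Two applications of the growth bound. The difference of the perturbed and the unperturbed
  trajectory solves an equation with defect \<open>s * \<delta> t *\<^sub>R B\<close>, so it is \<open>O(s)\<close> uniformly in time. After
  subtraction of \<open>s *\<^sub>R z t\<close> the defect that is left is the linearisation error of \<open>F\<close> over a distance
  \<open>O(s)\<close>, hence \<open>o(s)\<close>.\<close>

lemma endpoint_map_has_vector_derivative:
  assumes "0 \<le> T" and w: "continuous_on {0..T} w" and \<delta>: "continuous_on {0..T} \<delta>"
    and x: "trajectory rhs T w x0 x"
    and z: "ivp_solution T (\<lambda>t z. F' (x t) z + \<delta> t *\<^sub>R B) 0 z"
  shows "((\<lambda>s. endpoint_map rhs T (\<lambda>t. w t + s * \<delta> t) x0) has_vector_derivative z T) (at 0)"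
proof -
  have "\<exists>y. trajectory rhs T (\<lambda>t. w t + s * \<delta> t) x0 y" for s
    by (intro trajectory_exists \<open>0 \<le> T\<close> continuous_intros w \<delta>)
  then obtain X where X: "trajectory rhs T (\<lambda>t. w t + s * \<delta> t) x0 (X s)" for s
    by metis
  define C where "C = sqrt T * exp ((L + 1) * T)"
  have "0 \<le> C" using \<open>0 \<le> T\<close> by (simp add: C_def)
  have "bounded (\<delta> ` {0..T})"
    using \<delta> by (intro compact_imp_bounded compact_continuous_image) auto
  then obtain \<Delta> where \<Delta>: "0 < \<Delta>" "\<And>t. t \<in> {0..T} \<Longrightarrow> \<bar>\<delta> t\<bar> \<le> \<Delta>"
    unfolding bounded_pos by auto
  define k where "k = \<Delta> * norm B * C"
  have "0 \<le> k" using \<Delta>(1) \<open>0 \<le> C\<close> by (simp add: k_def)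
  have D: "(x has_vector_derivative F (x t) + w t *\<^sub>R B) (at t within {0..T})"
    "(X s has_vector_derivative F (X s t) + (w t + s * \<delta> t) *\<^sub>R B) (at t within {0..T})"
    "(z has_vector_derivative F' (x t) (z t) + \<delta> t *\<^sub>R B) (at t within {0..T})"
    if "t \<in> {0..T}" for t s
    using x X[of s] z that by (auto simp: trajectory_def ivp_solution_def)
  have init: "x 0 = x0" "X s 0 = x0" "z 0 = 0" for s
    using x X[of s] z by (auto simp: trajectory_def ivp_solution_def)
  have close: "norm (X s t - x t) \<le> \<bar>s\<bar> * k" if t: "t \<in> {0..T}" for s t
  proof -
    have "norm (X s t - x t) \<le> (\<bar>s\<bar> * \<Delta> * norm B) * (sqrt T * exp ((L + 1) * T))"
    proof (rule norm_growth_bound[where v = "\<lambda>t. X s t - x t"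
          and v' = "\<lambda>t. (F (X s t) + (w t + s * \<delta> t) *\<^sub>R B) - (F (x t) + w t *\<^sub>R B)"])
      fix t assume t: "t \<in> {0..T}"
      show "((\<lambda>t. X s t - x t) has_vector_derivative
          (F (X s t) + (w t + s * \<delta> t) *\<^sub>R B) - (F (x t) + w t *\<^sub>R B)) (at t within {0..T})"
        by (intro has_vector_derivative_diff D t)
      have "(F (X s t) + (w t + s * \<delta> t) *\<^sub>R B) - (F (x t) + w t *\<^sub>R B)
          = (F (X s t) - F (x t)) + (s * \<delta> t) *\<^sub>R B"
        by (simp add: algebra_simps)
      moreover have "norm ((s * \<delta> t) *\<^sub>R B) \<le> \<bar>s\<bar> * \<Delta> * norm B"
        using \<Delta>(2)[OF t] by (simp add: abs_mult mult_left_mono mult_right_mono)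
      ultimately show "norm ((F (X s t) + (w t + s * \<delta> t) *\<^sub>R B) - (F (x t) + w t *\<^sub>R B))
          \<le> L * norm (X s t - x t) + \<bar>s\<bar> * \<Delta> * norm B"
        using lipschitz_F[of "X s t" "x t"] by (metis add_mono norm_triangle_le)
    qed (use init \<Delta>(1) L_pos t in auto)
    then show ?thesis by (simp add: k_def C_def mult_ac)
  qed
  have main: "\<exists>d>0. \<forall>s. norm (s - 0) < d \<longrightarrow>
      norm (X s T - x T - (s - 0) *\<^sub>R z T) \<le> e * norm (s - 0)" if "0 < e" for e
  proof -
    \<comment> \<open>Chosen so that \<open>e' * k * C \<le> e\<close>; the summand 1 covers \<open>k * C = 0\<close>.\<close>
    define e' where "e' = e / (k * C + 1)"
    have "0 \<le> k * C" using \<open>0 \<le> k\<close> \<open>0 \<le> C\<close> by simp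
    then have "0 < e'" using \<open>0 < e\<close> by (simp add: e'_def)
    have "compact (x ` {0..T})"
      using trajectory_continuous[OF x] by (intro compact_continuous_image) auto
    then obtain d where d: "0 < d" "\<And>t y. t \<in> {0..T} \<Longrightarrow> norm (y - x t) < d \<Longrightarrow>
        norm (F y - F (x t) - F' (x t) (y - x t)) \<le> e' * norm (y - x t)"
      using linearisation_error[OF _ \<open>0 < e'\<close>] by (metis imageI)
    have "norm (X s T - x T - s *\<^sub>R z T) \<le> e * \<bar>s\<bar>" if s: "\<bar>s\<bar> < d / (k + 1)" for s
    proof -
      have "\<bar>s\<bar> * k \<le> \<bar>s\<bar> * (k + 1)" by (intro mult_left_mono) auto
      also have "\<dots> < d" using s \<open>0 \<le> k\<close> by (simp add: pos_less_divide_eq)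
      finally have sk: "\<bar>s\<bar> * k < d" .
      have "norm (X s T - x T - s *\<^sub>R z T) \<le> (e' * (\<bar>s\<bar> * k)) * (sqrt T * exp ((L + 1) * T))"
      proof (rule norm_growth_bound[where v = "\<lambda>t. X s t - x t - s *\<^sub>R z t"
            and v' = "\<lambda>t. (F (X s t) + (w t + s * \<delta> t) *\<^sub>R B) - (F (x t) + w t *\<^sub>R B)
              - s *\<^sub>R (F' (x t) (z t) + \<delta> t *\<^sub>R B)"])
        fix t assume t: "t \<in> {0..T}"
        let ?v = "(F (X s t) + (w t + s * \<delta> t) *\<^sub>R B) - (F (x t) + w t *\<^sub>R B)
              - s *\<^sub>R (F' (x t) (z t) + \<delta> t *\<^sub>R B)"
        show "((\<lambda>t. X s t - x t - s *\<^sub>R z t) has_vector_derivative ?v) (at t within {0..T})"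
          by (intro has_vector_derivative_diff D t
              bounded_linear.has_vector_derivative[OF bounded_linear_scaleR_right])
        have "?v = F' (x t) (X s t - x t - s *\<^sub>R z t) + (F (X s t) - F (x t) - F' (x t) (X s t - x t))"
          by (simp add: blinfun.diff_right blinfun.add_right blinfun.scaleR_right algebra_simps)
        moreover have "norm (F' (x t) (X s t - x t - s *\<^sub>R z t)) \<le> L * norm (X s t - x t - s *\<^sub>R z t)"
          by (rule order_trans[OF norm_blinfun]) (intro mult_right_mono norm_F'_le norm_ge_zero)
        moreover have "norm (F (X s t) - F (x t) - F' (x t) (X s t - x t)) \<le> e' * (\<bar>s\<bar> * k)"
        proof (rule order_trans[OF d(2)[OF t]])
          show "norm (X s t - x t) < d" using close[OF t, of s] sk by simp
          show "e' * norm (X s t - x t) \<le> e' * (\<bar>s\<bar> * k)"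
            using close[OF t, of s] \<open>0 < e'\<close> by (intro mult_left_mono) auto
        qed
        ultimately show "norm ?v \<le> L * norm (X s t - x t - s *\<^sub>R z t) + e' * (\<bar>s\<bar> * k)"
          by (metis add_mono norm_triangle_le)
      qed (use init \<open>0 \<le> k\<close> \<open>0 < e'\<close> L_pos \<open>0 \<le> T\<close> in auto)
      also have "\<dots> = (e * \<bar>s\<bar>) * (k * C / (k * C + 1))"
        by (simp add: e'_def C_def)
      also have "\<dots> \<le> e * \<bar>s\<bar>"
        using \<open>0 < e\<close> \<open>0 \<le> k * C\<close> by (intro mult_left_le) auto
      finally show ?thesis .
    qed
    then show ?thesis
      using d(1) \<open>0 \<le> k\<close> by (intro exI[of _ "d / (k + 1)"]) auto
  qed
  have "X 0 T = x T"
    using X[of 0] trajectory_unique[OF _ x, of "X 0" T] \<open>0 \<le> T\<close> by simp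
  then have "((\<lambda>s. X s T) has_vector_derivative z T) (at 0)"
    using main unfolding has_vector_derivative_def has_derivative_within_alt
    by (simp add: bounded_linear_scaleR_left)
  then show ?thesis
    using endpoint_map_eq[OF X \<open>0 \<le> T\<close>] by simp
qed

text \<open>The hypothesis says that \<open>B\<close> and \<open>F' x B\<close>, which is up to sign the Lie bracket of the drift with
  the constant field \<open>B\<close>, span the space at every point \<open>x\<close>. If the range of the derivative were a
  proper subspace, a normal vector of it would be orthogonal to both of them at the end point of
  the reference trajectory.\<close>

lemma locally_controllable_if_spanning:
  assumes "0 < T" and bracket: "\<And>x p. p \<bullet> B = 0 \<Longrightarrow> p \<bullet> F' x B = 0 \<Longrightarrow> p = 0"
  shows "locally_controllable rhs T x0"
  unfolding locally_controllable_def
proof (intro allI impI conjI)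
  fix w assume "smooth_on_interval 0 T w"
  then have w: "continuous_on {0..T} w" by (rule smooth_on_interval_continuous)
  show "endpoint_map_defined rhs T w x0"
    using endpoint_map_defined[OF w] \<open>0 < T\<close> by simp
  obtain x where x: "trajectory rhs T w x0 x"
    using trajectory_exists[OF w] \<open>0 < T\<close> by (meson less_imp_le)
  note M = continuous_linearisation[OF x]
  define lin where "lin \<delta> = ivp_solution T (\<lambda>t z. F' (x t) z + \<delta> t *\<^sub>R B) 0" for \<delta> :: "real \<Rightarrow> real"
  \<comment> \<open>The value on a control that is not smooth is arbitrary if the linearised equation has no solution.\<close>
  define D where "D \<delta> = (SOME z. lin \<delta> z) T" for \<delta>
  have lin: "\<exists>z. lin \<delta> z" if "smooth_on_interval 0 T \<delta>" for \<delta>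
    unfolding lin_def using that \<open>0 < T\<close>
    by (intro linear_ivp_exists[OF M] continuous_intros smooth_on_interval_continuous) auto
  have D: "D \<delta> = z T" if "lin \<delta> z" for \<delta> z
  proof -
    have "lin \<delta> (SOME z. lin \<delta> z)" by (rule someI[of "lin \<delta>", OF that])
    then show ?thesis
      unfolding D_def
      by (intro linear_ivp_unique[OF M]) (use that \<open>0 < T\<close> in \<open>auto simp: lin_def\<close>)
  qed
  have D_comb: "D (\<lambda>t. a * \<delta> t + b * \<eta> t) = a *\<^sub>R D \<delta> + b *\<^sub>R D \<eta>"
    if \<delta>: "smooth_on_interval 0 T \<delta>" and \<eta>: "smooth_on_interval 0 T \<eta>" for \<delta> \<eta> a b
  proof -
    obtain y z where yz: "lin \<delta> y" "lin \<eta> z"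
      using lin \<delta> \<eta> by blast
    then have "lin (\<lambda>t. a * \<delta> t + b * \<eta> t) (\<lambda>t. a *\<^sub>R y t + b *\<^sub>R z t)"
      using linear_ivp_combination[of T "\<lambda>t. F' (x t)" "\<lambda>t. \<delta> t *\<^sub>R B" 0 y "\<lambda>t. \<eta> t *\<^sub>R B" 0 z a b]
      by (simp add: lin_def scaleR_add_left)
    then show ?thesis
      using D yz by simp
  qed
  have "has_endpoint_derivative rhs T w x0 D"
    unfolding has_endpoint_derivative_def
  proof (intro conjI allI impI)
    fix \<delta> assume \<delta>: "smooth_on_interval 0 T \<delta>"
    then obtain z where z: "lin \<delta> z" using lin by blast
    show "((\<lambda>s. endpoint_map rhs T (\<lambda>t. w t + s * \<delta> t) x0) has_vector_derivative D \<delta>) (at 0)"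
      unfolding D[OF z]
      by (rule endpoint_map_has_vector_derivative[OF _ w smooth_on_interval_continuous[OF \<delta>] x])
        (use z \<open>0 < T\<close> in \<open>auto simp: lin_def\<close>)
  qed (rule D_comb)
  moreover have "D ` {\<delta>. smooth_on_interval 0 T \<delta>} = UNIV"
  proof (rule ccontr)
    let ?R = "D ` {\<delta>. smooth_on_interval 0 T \<delta>}"
    assume "?R \<noteq> UNIV"
    moreover have "subspace ?R"
    proof (rule subspaceI)
      have zero: "smooth_on_interval 0 T (\<lambda>_. 0)"
        by (intro smooth_on_interval_polynomial real_polynomial_function.intros(2))
      from D_comb[OF zero zero, of 0 0] have "D (\<lambda>_. 0) = 0" by simp
      then show "0 \<in> ?R" using zero by (metis imageI mem_Collect_eq)
    next
      fix u v assume "u \<in> ?R" "v \<in> ?R"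
      then obtain \<delta> \<eta> where *: "smooth_on_interval 0 T \<delta>" "smooth_on_interval 0 T \<eta>" "u = D \<delta>" "v = D \<eta>"
        by auto
      have "u + v = D (\<lambda>t. 1 * \<delta> t + 1 * \<eta> t)"
        by (subst D_comb) (use * in auto)
      then show "u + v \<in> ?R"
        using smooth_on_interval_combination[OF *(1,2), of 1 1] by blast
    next
      fix c u assume "u \<in> ?R"
      then obtain \<delta> where *: "smooth_on_interval 0 T \<delta>" "u = D \<delta>"
        by auto
      have "c *\<^sub>R u = D (\<lambda>t. c * \<delta> t + 0 * \<delta> t)"
        by (subst D_comb) (use * in auto)
      then show "c *\<^sub>R u \<in> ?R"
        using smooth_on_interval_combination[OF *(1,1), of c 0] by blast
    qed
    ultimately have "span ?R \<noteq> UNIV" by (simp add: span_eq_iff[THEN iffD2])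
    then obtain p where p: "p \<noteq> 0" "\<And>v. v \<in> ?R \<Longrightarrow> p \<bullet> v = 0"
      using span_not_UNIV_orthogonal span_base by metis
    have orth: "p \<bullet> z T = 0" if "smooth_on_interval 0 T \<delta>"
      "ivp_solution T (\<lambda>t z. F' (x t) z + \<delta> t *\<^sub>R B) 0 z" for \<delta> z
      using p(2) D[of \<delta> z] that unfolding lin_def by (metis imageI mem_Collect_eq)
    have "p \<bullet> B = 0" "p \<bullet> F' (x T) B = 0"
      using endpoint_orthogonal_imp[where B = B and p = p, OF \<open>0 < T\<close> M] orth by blast+
    then show False using bracket p(1) by blast
  qed
  ultimately show "\<exists>D. has_endpoint_derivative rhs T w x0 D \<and> D ` {\<delta>. smooth_on_interval 0 T \<delta>} = UNIV"
    by blast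
qed

end


section \<open>The planar case\<close>

lemma kalman_matrix_mult: "kalman_matrix A B *v vector [a, b] = a *\<^sub>R B + b *\<^sub>R (A *v B)"
proof -
  have "transpose (vector [B, C] :: real^2^2) *v vector [a, b] = a *\<^sub>R B + b *\<^sub>R C" for C :: "real^2"
    by (simp add: vec_eq_iff forall_2 matrix_vector_mult_def transpose_def sum_2 mult.commute)
  then show ?thesis by (simp add: kalman_matrix_def)
qed

lemma linear_controllable_imp:
  assumes "linear_controllable A B"
  shows "B \<noteq> 0" and "A *v B \<noteq> l *\<^sub>R B"
proof -
  have "inj ((*v) (kalman_matrix A B))"
    using assms full_rank_injective[of "kalman_matrix A B"] by (simp add: linear_controllable_def)
  then have inj: "a = c \<and> b = d"
    if "a *\<^sub>R B + b *\<^sub>R (A *v B) = c *\<^sub>R B + d *\<^sub>R (A *v B)" for a b c d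
    using injD[of "(*v) (kalman_matrix A B)" "vector [a, b]" "vector [c, d]"] that
    by (metis kalman_matrix_mult vector_2)
  show "B \<noteq> 0" using inj[of 1 0 0 0] by auto
  show "A *v B \<noteq> l *\<^sub>R B" using inj[of 0 1 l 0] by auto
qed

lemma norm_diff_projection_le:
  fixes v B :: "'a::real_inner"
  assumes "B \<noteq> 0"
  shows "norm (v - (v \<bullet> B / (norm B)\<^sup>2) *\<^sub>R B) \<le> norm (v - l *\<^sub>R B)"
proof -
  define c where "c = v \<bullet> B / (norm B)\<^sup>2"
  have "(v - c *\<^sub>R B) \<bullet> B = 0"
    using assms by (simp add: c_def inner_diff_left dot_square_norm)
  then have "orthogonal (v - c *\<^sub>R B) ((c - l) *\<^sub>R B)"
    by (simp add: orthogonal_def)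
  from norm_add_Pythagorean[OF this]
  have "(norm (v - l *\<^sub>R B))\<^sup>2 = (norm (v - c *\<^sub>R B))\<^sup>2 + (norm ((c - l) *\<^sub>R B))\<^sup>2"
    by (simp add: algebra_simps)
  then have "(norm (v - c *\<^sub>R B))\<^sup>2 \<le> (norm (v - l *\<^sub>R B))\<^sup>2" by simp
  then show ?thesis
    unfolding c_def by (rule power2_le_imp_le) simp
qed

lemma m_const_le: "m_const A B \<le> norm (A *v B - l *\<^sub>R B)"
  unfolding m_const_def by (rule cINF_lower) (auto intro: bdd_belowI[of _ 0])

lemma m_const_eq_projection:
  assumes "B \<noteq> 0"
  shows "m_const A B = norm (A *v B - ((A *v B) \<bullet> B / (norm B)\<^sup>2) *\<^sub>R B)"
proof (rule antisym[OF m_const_le])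
  show "norm (A *v B - ((A *v B) \<bullet> B / (norm B)\<^sup>2) *\<^sub>R B) \<le> m_const A B"
    unfolding m_const_def by (rule cINF_greatest) (simp_all add: norm_diff_projection_le[OF assms])
qed

text \<open>Otherwise \<open>p\<close>, \<open>B\<close> and the component of \<open>u\<close> normal to \<open>B\<close> would be three independent vectors in
  the plane.\<close>

lemma planar_orthogonal_imp_parallel:
  fixes p B u :: "real^2"
  assumes "p \<noteq> 0" "B \<noteq> 0" "p \<bullet> B = 0" "p \<bullet> u = 0"
  obtains l where "u = l *\<^sub>R B"
proof -
  define d where "d = u - (u \<bullet> B / (norm B)\<^sup>2) *\<^sub>R B"
  have dB: "d \<bullet> B = 0" and dp: "d \<bullet> p = 0"
    using assms
    by (simp_all add: d_def inner_diff_left dot_square_norm inner_commute[of u p] inner_commute[of B p])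
  have "d = 0"
  proof (rule ccontr)
    assume "d \<noteq> 0"
    have "independent {d, B, p}"
      using \<open>d \<noteq> 0\<close> assms dB dp
      by (intro pairwise_orthogonal_independent) (auto simp: pairwise_insert orthogonal_def inner_commute)
    then have "card {d, B, p} \<le> 2"
      using independent_bound by fastforce
    moreover have "d \<noteq> B" "d \<noteq> p" "B \<noteq> p"
      using assms dB dp by (metis inner_eq_zero_iff)+
    ultimately show False by simp
  qed
  then show thesis by (intro that[of "u \<bullet> B / (norm B)\<^sup>2"]) (simp add: d_def)
qed

theorem mainTheorem2:
  fixes A :: "real^2^2" and B :: "real^2" and f :: "real^2 \<Rightarrow> real^2"
  assumes "linear_controllable A B"
    and "smooth f"
    and "\<And>x. onorm ((*v) (jacobian f (at x))) < m_const A B / norm B"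
  shows "(\<exists>l. m_const A B = norm (A *v B - l *\<^sub>R B)) \<and>
    m_const A B = norm (A *v B - ((A *v B) \<bullet> B / (norm B)\<^sup>2) *\<^sub>R B) \<and>
    m_const A B > 0 \<and>
    (\<forall>T x0. T > 0 \<longrightarrow>
       locally_controllable (\<lambda>x u. A *v x + u *\<^sub>R B + f x) T x0)"
proof (intro conjI allI impI)
  have "B \<noteq> 0" by (rule linear_controllable_imp[OF assms(1)])
  then show m_eq: "m_const A B = norm (A *v B - ((A *v B) \<bullet> B / (norm B)\<^sup>2) *\<^sub>R B)"
    by (rule m_const_eq_projection)
  then show "\<exists>l. m_const A B = norm (A *v B - l *\<^sub>R B)" by blast
  show m_pos: "m_const A B > 0"
    using linear_controllable_imp(2)[OF assms(1)] by (simp add: m_eq)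
  fix T :: real and x0 :: "real^2" assume "0 < T"
  define L where "L = onorm ((*v) A) + m_const A B / norm B"
  define F' where "F' x = Blinfun ((*v) (A + jacobian f (at x)))" for x
  have F': "F' x v = A *v v + jacobian f (at x) *v v" for x v
    unfolding F'_def
    by (subst bounded_linear_Blinfun_apply)
      (simp_all add: matrix_vector_mul_bounded_linear matrix_vector_mult_add_rdistrib)
  have Df: "(f has_derivative (\<lambda>v. jacobian f (at x) *v v)) (at x)"
    and Df_cont: "continuous_on UNIV (\<lambda>x. jacobian f (at x) *v v)" for x v
  proof -
    have "Ck (Suc 0) f" using assms(2) unfolding smooth_def by blast
    then have "f differentiable (at x)" for x by simp
    then show D: "(f has_derivative (\<lambda>v. jacobian f (at x) *v v)) (at x)" for x
      by (simp add: jacobian_works)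
    from \<open>Ck (Suc 0) f\<close> show "continuous_on UNIV (\<lambda>x. jacobian f (at x) *v v)"
      using frechet_derivative_at[OF D] by simp
  qed
  interpret control_affine "\<lambda>x. A *v x + f x" F' L B
  proof
    fix x
    show "((\<lambda>x. A *v x + f x) has_derivative blinfun_apply (F' x)) (at x)"
      by (rule has_derivative_eq_rhs[OF has_derivative_add[OF
              bounded_linear_imp_has_derivative[OF matrix_vector_mul_bounded_linear] Df]])
        (simp add: F' fun_eq_iff)
    have "norm (F' x v) \<le> L * norm v" for v
    proof -
      have "norm (F' x v) \<le> norm (A *v v) + norm (jacobian f (at x) *v v)"
        unfolding F' by (rule norm_triangle_ineq)
      also have "\<dots> \<le> onorm ((*v) A) * norm v + onorm ((*v) (jacobian f (at x))) * norm v"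
        by (intro add_mono onorm matrix_vector_mul_bounded_linear)
      also have "\<dots> \<le> L * norm v"
        using less_imp_le[OF assms(3)[of x]]
        unfolding L_def distrib_right by (intro add_left_mono mult_right_mono norm_ge_zero)
      finally show ?thesis .
    qed
    moreover show "0 < L"
      using m_pos \<open>B \<noteq> 0\<close> onorm_pos_le[OF matrix_vector_mul_bounded_linear[of A]]
      by (simp add: L_def add_nonneg_pos)
    ultimately show "norm (F' x) \<le> L"
      by (intro norm_blinfun_bound) auto
  next
    show "continuous_on UNIV F'"
      by (intro continuous_on_blinfun_componentwise) (simp add: F' continuous_on_add Df_cont)
  qed
  have "locally_controllable rhs T x0"
  proof (rule locally_controllable_if_spanning[OF \<open>0 < T\<close>], rule ccontr)
    fix x p assume p: "p \<bullet> B = 0" "p \<bullet> F' x B = 0" "p \<noteq> 0"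
    let ?J = "jacobian f (at x)"
    obtain l where "F' x B = l *\<^sub>R B"
      using planar_orthogonal_imp_parallel[OF \<open>p \<noteq> 0\<close> \<open>B \<noteq> 0\<close> p(1,2)] by blast
    \<comment> \<open>Such an \<open>l\<close> contradicts the minimality of \<open>m_const\<close>, because \<open>?J *v B\<close> is too short.\<close>
    then have "A *v B - l *\<^sub>R B = - (?J *v B)"
      by (simp add: F' algebra_simps)
    then have "m_const A B \<le> norm (?J *v B)"
      using m_const_le[of A B l] by simp
    also have "\<dots> \<le> onorm ((*v) ?J) * norm B"
      by (rule onorm[OF matrix_vector_mul_bounded_linear])
    also have "\<dots> < m_const A B"
      using assms(3)[of x] \<open>B \<noteq> 0\<close> by (simp add: pos_less_divide_eq)
    finally show False by simp
  qed
  then show "locally_controllable (\<lambda>x u. A *v x + u *\<^sub>R B + f x) T x0"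
    by (simp add: add_ac)
qed

end
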